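(* Whether a payment-free Shapley operator has only trivial fixed points depends only on the supports of its transition probabilities. Precisely: let $S=\{1,\dots,n\}$, let $A_i$ ($i\in S$) and $B_{i,a}$ ($i\in S$, $a\in A_i$) be nonempty finite sets, and let $(P_i^{ab})$ and $(Q_i^{ab})$, indexed by $i\in S$, $a\in A_i$, $b\in B_{i,a}$, be two families of probabilities over $S$ such that for all $i\in S$, $a\in A_i$, $b\in B_{i,a}$ the supports of $P_i^{ab}$ and $Q_i^{ab}$ coincide. Let $F,G:\mathbb{R}^n\to\mathbb{R}^n$ be the payment-free Shapley operators $$[F(x)]_i=\min_{a\in A_i}\max_{b\in B_{i,a}}P_i^{ab}x,\qquad [G(x)]_i=\min_{a\in A_i}\max_{b\in B_{i,a}}Q_i^{ab}x,\qquad i\in S.$$ Then $F$ has only trivial fixed points if and only if $G$ has only trivial fixed points.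
   Context: A probability $P=(P_j)_{j\in S}$ over $S$ is seen as a row vector, so that $Px=\sum_{j=1}^n P_jx_j$ for $x\in\mathbb{R}^n$. The support of $P$ is $\{j\in S\mid P_j\neq 0\}$. Let $\mathbf{1}=(1,\dots,1)\in\mathbb{R}^n$ be the unit vector. Every vector proportional to $\mathbf{1}$ is a fixed point of a payment-free Shapley operator; a fixed point is called trivial if it is proportional to $\mathbf{1}$. *)

theory Defs
  imports "HOL-Analysis.Analysis" "HOL-Probability.Probability_Mass_Function"
begin

text \<open>The state space \<open>S = {1,\<dots>,n}\<close> is a finite type \<open>'n\<close>; a probability over \<open>S\<close> is an \<open>'n pmf\<close>,
  with support \<^const>\<open>set_pmf\<close>.\<close>

definition row_vec :: "'n::finite pmf \<Rightarrow> real ^ 'n" where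
  "row_vec P = (\<chi> j. pmf P j)"

text \<open>\<^const>\<open>Min\<close> and \<^const>\<open>Max\<close> are meaningful only for finite nonempty sets, so this is the
  intended operator only if all \<open>A i\<close>, and all \<open>B i a\<close> with \<open>a \<in> A i\<close>, are finite and nonempty.\<close>

definition payment_free_shapley ::
  "('n \<Rightarrow> 'a set) \<Rightarrow> ('n \<Rightarrow> 'a \<Rightarrow> 'b set) \<Rightarrow> ('n \<Rightarrow> 'a \<Rightarrow> 'b \<Rightarrow> 'n pmf) \<Rightarrow> real ^ 'n \<Rightarrow> real ^ 'n::finite"
  where
  "payment_free_shapley A B P x = (\<chi> i. MIN a\<in>A i. MAX b\<in>B i a. row_vec (P i a b) \<bullet> x)"

definition trivial_vec :: "real ^ 'n::finite \<Rightarrow> bool" where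
  "trivial_vec x \<longleftrightarrow> (\<exists>c. x = c *\<^sub>R 1)"

definition only_trivial_fixed_points :: "(real ^ 'n \<Rightarrow> real ^ 'n::finite) \<Rightarrow> bool" where
  "only_trivial_fixed_points F \<longleftrightarrow> (\<forall>x. F x = x \<longrightarrow> trivial_vec x)"

end

theory Submission
  imports Defs
begin

text \<open>
  Let \<open>x\<close> be a nontrivial fixed point, and let \<open>I\<close> and \<open>J\<close> be the disjoint sets of states at which \<open>x\<close>
  is minimal and maximal. An average of \<open>x\<close> attains an extremal value of \<open>x\<close> only if the
  averaging probability is supported where \<open>x\<close> is extremal; so Min has actions that force the
  state to stay in \<open>I\<close>, and Max has actions that force it to stay in \<open>J\<close>. Conversely, if such
  disjoint nonempty \<open>I\<close> and \<open>J\<close> exist, then the operator, which is monotone, maps the order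
  interval of the vectors in \<open>[0,1]^n\<close> that are 0 on \<open>I\<close> and 1 on \<open>J\<close> to itself, and the
  Knaster--Tarski argument gives a fixed point there. The existence of \<open>I\<close> and \<open>J\<close> involves the
  probabilities only through their supports.
\<close>

text \<open>Knaster--Tarski on the order interval from \<open>a\<close> to \<open>b\<close>:
  conditional completeness suffices, because the set \<open>K\<close> of points below their image
  contains \<open>a\<close> and is bounded by \<open>b\<close>. This covers
  \<open>real ^ 'n\<close>, which is not a complete lattice.\<close>

lemma mono_fixed_point_between:
  fixes F :: "'a::conditionally_complete_lattice \<Rightarrow> 'a"
  assumes "mono F" "a \<le> b" "a \<le> F a" "F b \<le> b"
  shows "\<exists>x. a \<le> x \<and> x \<le> b \<and> F x = x"
proof -
  define K where "K = {z. a \<le> z \<and> z \<le> b \<and> z \<le> F z}"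
  have aK: "a \<in> K"
    using assms by (simp add: K_def)
  have bdd: "bdd_above K"
    by (auto simp: K_def)
  define x where "x = Sup K"
  have ax: "a \<le> x"
    unfolding x_def using aK bdd by (rule cSup_upper)
  have xb: "x \<le> b"
    unfolding x_def using aK by (intro cSup_least) (auto simp: K_def)
  have xF: "x \<le> F x"
    unfolding x_def
  proof (rule cSup_least)
    fix z assume z: "z \<in> K"
    then have "z \<le> F z" by (simp add: K_def)
    also have "\<dots> \<le> F (Sup K)"
      using z bdd by (intro monoD[OF \<open>mono F\<close>] cSup_upper)
    finally show "z \<le> F (Sup K)" .
  qed (use aK in blast)
  \<comment> \<open>Applying \<open>F\<close> to \<open>x \<le> F x\<close> shows that
    \<open>F x\<close> also lies below its image, so it cannot exceed the supremum
    \<open>x\<close>.\<close>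
  have "F x \<in> K"
    using monoD[OF \<open>mono F\<close> xF] monoD[OF \<open>mono F\<close> xb] ax xb xF assms
    by (auto simp: K_def)
  then have "F x \<le> x"
    unfolding x_def using bdd by (intro cSup_upper)
  with ax xb xF show ?thesis
    by (auto intro: antisym)
qed

lemma inner_row_vec: "row_vec p \<bullet> x = (\<Sum>j\<in>UNIV. pmf p j * x $ j)"
  by (simp add: row_vec_def inner_vec_def)

lemma inner_row_vec_const:
  assumes "\<And>j. j \<in> set_pmf p \<Longrightarrow> x $ j = c"
  shows "row_vec p \<bullet> x = c"
proof -
  have "row_vec p \<bullet> x = (\<Sum>j\<in>UNIV. pmf p j * c)"
    unfolding inner_row_vec using assms by (intro sum.cong) (auto simp: set_pmf_iff)
  then show ?thesis
    by (simp add: sum_pmf_eq_1 flip: sum_distrib_right)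
qed

lemma inner_row_vec_mono: "x \<le> y \<Longrightarrow> row_vec p \<bullet> x \<le> row_vec p \<bullet> y"
  unfolding inner_row_vec by (intro sum_mono mult_left_mono) (auto simp: less_eq_vec_def)

text \<open>The coordinate \<open>j\<close> has positive weight, so its strict gap survives
  averaging.\<close>

lemma inner_row_vec_mono_strict:
  assumes "x \<le> y" "j \<in> set_pmf p" "x $ j < y $ j"
  shows "row_vec p \<bullet> x < row_vec p \<bullet> y"
  unfolding inner_row_vec
proof (rule sum_strict_mono_ex1)
  show "\<forall>k\<in>UNIV. pmf p k * x $ k \<le> pmf p k * y $ k"
    using assms(1) by (auto intro: mult_left_mono simp: less_eq_vec_def)
  show "\<exists>k\<in>UNIV. pmf p k * x $ k < pmf p k * y $ k"
    using assms(2,3) by (auto intro!: exI[of _ j] simp: pmf_positive)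
qed simp

locale finite_actions =
  fixes A :: "'n::finite \<Rightarrow> 'a set" and B :: "'n \<Rightarrow> 'a \<Rightarrow> 'b set"
  assumes finA: "\<And>i. finite (A i)" and neA: "\<And>i. A i \<noteq> {}"
    and finB: "\<And>i a. a \<in> A i \<Longrightarrow> finite (B i a)" and neB: "\<And>i a. a \<in> A i \<Longrightarrow> B i a \<noteq> {}"
begin

text \<open>Minima and maxima over finite nonempty sets are attained, so bounds on the operator
  become choices of actions. The quantifiers here are those in the condition on \<open>I\<close>
  below; the dual lemma yields those for \<open>J\<close>.\<close>

lemma shapley_le_iff:
  "payment_free_shapley A B P x $ i \<le> t \<longleftrightarrow> (\<exists>a\<in>A i. \<forall>b\<in>B i a. row_vec (P i a b) \<bullet> x \<le> t)"
  by (simp add: payment_free_shapley_def Min_le_iff Max_le_iff finA neA finB neB cong: bex_cong)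

lemma le_shapley_iff:
  "t \<le> payment_free_shapley A B P x $ i \<longleftrightarrow> (\<forall>a\<in>A i. \<exists>b\<in>B i a. t \<le> row_vec (P i a b) \<bullet> x)"
  by (simp add: payment_free_shapley_def Min_ge_iff Max_ge_iff finA neA finB neB cong: ball_cong)

lemma mono_shapley: "mono (payment_free_shapley A B P)"
proof (rule monoI, unfold less_eq_vec_def, rule allI)
  fix x y :: "real ^ 'n" and i
  assume "\<forall>i. x $ i \<le> y $ i"
  then have le: "row_vec p \<bullet> x \<le> row_vec p \<bullet> y" for p
    by (simp add: inner_row_vec_mono less_eq_vec_def)
  \<comment> \<open>An action of Min that is optimal against \<open>y\<close> does at least as well
    against the smaller \<open>x\<close>.\<close>
  obtain a where "a \<in> A i"
    "\<forall>b\<in>B i a. row_vec (P i a b) \<bullet> y \<le> payment_free_shapley A B P y $ i"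
    using shapley_le_iff[of P y i "payment_free_shapley A B P y $ i"] by auto
  then show "payment_free_shapley A B P x $ i \<le> payment_free_shapley A B P y $ i"
    unfolding shapley_le_iff using le order_trans by blast
qed

lemma nontrivial_fixed_point_iff:
  "(\<exists>x. payment_free_shapley A B P x = x \<and> \<not> trivial_vec x) \<longleftrightarrow>
   (\<exists>I J. I \<noteq> {} \<and> J \<noteq> {} \<and> I \<inter> J = {} \<and>
     (\<forall>i\<in>I. \<exists>a\<in>A i. \<forall>b\<in>B i a. set_pmf (P i a b) \<subseteq> I) \<and>
     (\<forall>j\<in>J. \<forall>a\<in>A j. \<exists>b\<in>B j a. set_pmf (P j a b) \<subseteq> J))"
  (is "?L \<longleftrightarrow> ?R")
proof
  assume ?L
  then obtain x where fix_x: "payment_free_shapley A B P x = x" and nontriv: "\<not> trivial_vec x"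
    by blast
  define m where "m = Min (range (($) x))"
  define M where "M = Max (range (($) x))"
  have m: "m \<le> x $ j" and M: "x $ j \<le> M" for j
    by (simp_all add: m_def M_def)
  \<comment> \<open>Comparison with the constant vector \<open>m\<close>, whose average is
    \<open>m\<close>: a support point where \<open>x\<close> exceeds \<open>m\<close> would push the
    average of \<open>x\<close> above \<open>m\<close>.\<close>
  have supp_m: "set_pmf p \<subseteq> {j. x $ j = m}" if "row_vec p \<bullet> x \<le> m" for p
  proof (rule ccontr)
    assume "\<not> ?thesis"
    then obtain j where "j \<in> set_pmf p" "m < x $ j"
      using m by (auto simp: order_less_le)
    then have "row_vec p \<bullet> (\<chi> j. m) < row_vec p \<bullet> x"
      using m by (intro inner_row_vec_mono_strict) (auto simp: less_eq_vec_def)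
    with that show False
      by (simp add: inner_row_vec_const)
  qed
  have supp_M: "set_pmf p \<subseteq> {j. x $ j = M}" if "M \<le> row_vec p \<bullet> x" for p
  proof (rule ccontr)
    assume "\<not> ?thesis"
    then obtain j where "j \<in> set_pmf p" "x $ j < M"
      using M by (auto simp: order_less_le)
    then have "row_vec p \<bullet> x < row_vec p \<bullet> (\<chi> j. M)"
      using M by (intro inner_row_vec_mono_strict) (auto simp: less_eq_vec_def)
    with that show False
      by (simp add: inner_row_vec_const)
  qed
  have "m \<noteq> M"
  proof
    assume "m = M"
    then have "x = m *\<^sub>R 1"
      using m M by (auto simp: vec_eq_iff intro: antisym)
    with nontriv show False
      by (auto simp: trivial_vec_def)
  qed
  have "m \<in> range (($) x)" "M \<in> range (($) x)"
    unfolding m_def M_def by (intro Min_in Max_in; simp)+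
  show ?R
  proof (intro exI conjI)
    show "{j. x $ j = m} \<noteq> {}" "{j. x $ j = M} \<noteq> {}"
      using \<open>m \<in> _\<close> \<open>M \<in> _\<close> by auto
    show "{j. x $ j = m} \<inter> {j. x $ j = M} = {}"
      using \<open>m \<noteq> M\<close> by auto
    show "\<forall>i\<in>{j. x $ j = m}. \<exists>a\<in>A i. \<forall>b\<in>B i a. set_pmf (P i a b) \<subseteq> {j. x $ j = m}"
    proof
      fix i assume "i \<in> {j. x $ j = m}"
      then have "payment_free_shapley A B P x $ i \<le> m" by (simp add: fix_x)
      then show "\<exists>a\<in>A i. \<forall>b\<in>B i a. set_pmf (P i a b) \<subseteq> {j. x $ j = m}"
        unfolding shapley_le_iff using supp_m by blast
    qed
    show "\<forall>i\<in>{j. x $ j = M}. \<forall>a\<in>A i. \<exists>b\<in>B i a. set_pmf (P i a b) \<subseteq> {j. x $ j = M}"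
    proof
      fix i assume "i \<in> {j. x $ j = M}"
      then have "M \<le> payment_free_shapley A B P x $ i" by (simp add: fix_x)
      then show "\<forall>a\<in>A i. \<exists>b\<in>B i a. set_pmf (P i a b) \<subseteq> {j. x $ j = M}"
        unfolding le_shapley_iff using supp_M by blast
    qed
  qed
next
  assume ?R
  then obtain I J where "I \<noteq> {}" "J \<noteq> {}" and disj: "I \<inter> J = {}"
    and I: "\<And>i. i \<in> I \<Longrightarrow> \<exists>a\<in>A i. \<forall>b\<in>B i a. set_pmf (P i a b) \<subseteq> I"
    and J: "\<And>j a. j \<in> J \<Longrightarrow> a \<in> A j \<Longrightarrow> \<exists>b\<in>B j a. set_pmf (P j a b) \<subseteq> J"
    by metis
  \<comment> \<open>The least and the greatest vector of the unit cube that are 0 on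
    \<open>I\<close> and 1 on \<open>J\<close>; disjointness makes \<open>l \<le> u\<close>.\<close>
  define l u :: "real ^ 'n" where "l = (\<chi> j. if j \<in> J then 1 else 0)"
    and "u = (\<chi> j. if j \<in> I then 0 else 1)"
  have l_nonneg: "0 \<le> row_vec p \<bullet> l" for p
    using inner_row_vec_mono[of 0 l p] by (simp add: l_def less_eq_vec_def)
  have u_le_1: "row_vec p \<bullet> u \<le> 1" for p
    using inner_row_vec_mono[of u "\<chi> j. 1" p]
    by (simp add: u_def less_eq_vec_def inner_row_vec_const)
  have l_J: "row_vec p \<bullet> l = 1" if "set_pmf p \<subseteq> J" for p
    using that by (intro inner_row_vec_const) (auto simp: l_def)
  have u_I: "row_vec p \<bullet> u = 0" if "set_pmf p \<subseteq> I" for p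
    using that by (intro inner_row_vec_const) (auto simp: u_def)
  \<comment> \<open>On \<open>J\<close>, Max answers each action by staying in \<open>J\<close>,
    which yields 1. Elsewhere \<open>l\<close> is 0 and any answer will do.\<close>
  have "l $ i \<le> payment_free_shapley A B P l $ i" for i
    unfolding le_shapley_iff
  proof
    fix a assume a: "a \<in> A i"
    show "\<exists>b\<in>B i a. l $ i \<le> row_vec (P i a b) \<bullet> l"
    proof (cases "i \<in> J")
      case True
      then have "l $ i = 1" by (simp add: l_def)
      then show ?thesis using J[OF True a] l_J by (metis order_refl)
    next
      case False
      then show ?thesis using neB[OF a] l_nonneg by (auto simp: l_def)
    qed
  qed
  moreover have "payment_free_shapley A B P u $ i \<le> u $ i" for i
    unfolding shapley_le_iff
  proof (cases "i \<in> I")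
    case True
    then show "\<exists>a\<in>A i. \<forall>b\<in>B i a. row_vec (P i a b) \<bullet> u \<le> u $ i"
      using I[OF True] u_I by (fastforce simp: u_def)
  next
    case False
    then show "\<exists>a\<in>A i. \<forall>b\<in>B i a. row_vec (P i a b) \<bullet> u \<le> u $ i"
      using neA[of i] u_le_1 by (auto simp: u_def)
  qed
  moreover have "l \<le> u"
    using disj by (auto simp: less_eq_vec_def l_def u_def)
  ultimately obtain x where "l \<le> x" "x \<le> u" and fix_x: "payment_free_shapley A B P x = x"
    using mono_fixed_point_between[OF mono_shapley, of l u P] by (auto simp: less_eq_vec_def)
  obtain i j where "i \<in> I" "j \<in> J"
    using \<open>I \<noteq> {}\<close> \<open>J \<noteq> {}\<close> by blast
  then have "x $ i \<le> 0" "1 \<le> x $ j"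
    using \<open>l \<le> x\<close> \<open>x \<le> u\<close> by (auto simp: less_eq_vec_def l_def u_def split: if_splits dest!: spec)
  then have "\<not> trivial_vec x"
    by (auto simp: trivial_vec_def)
  with fix_x show ?L by blast
qed

end

theorem theorem5:
  fixes A :: "'n::finite \<Rightarrow> 'a set"
    and B :: "'n \<Rightarrow> 'a \<Rightarrow> 'b set"
    and P Q :: "'n \<Rightarrow> 'a \<Rightarrow> 'b \<Rightarrow> 'n pmf"
  assumes "\<And>i. finite (A i)" and "\<And>i. A i \<noteq> {}"
    and "\<And>i a. a \<in> A i \<Longrightarrow> finite (B i a)" and "\<And>i a. a \<in> A i \<Longrightarrow> B i a \<noteq> {}"
    and "\<And>i a b. a \<in> A i \<Longrightarrow> b \<in> B i a \<Longrightarrow> set_pmf (P i a b) = set_pmf (Q i a b)"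
  shows "only_trivial_fixed_points (payment_free_shapley A B P) \<longleftrightarrow>
         only_trivial_fixed_points (payment_free_shapley A B Q)"
proof -
  interpret finite_actions A B
    by unfold_locales (fact assms)+
  have "(\<exists>x. payment_free_shapley A B P x = x \<and> \<not> trivial_vec x) \<longleftrightarrow>
        (\<exists>x. payment_free_shapley A B Q x = x \<and> \<not> trivial_vec x)"
    \<comment> \<open>The congruence rules supply the memberships in \<open>A i\<close> and
      \<open>B i a\<close> under which the supports are known to agree.\<close>
    unfolding nontrivial_fixed_point_iff using assms(5) by (simp cong: ball_cong bex_cong)
  then show ?thesis
    unfolding only_trivial_fixed_points_def by blast
qed

end
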